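(* In the setting described in the context, the consistent solution $P^{\mathrm{post}}_{\Lambda}$ of the stochastic inverse problem is stable with respect to perturbations in $P^{\mathrm{prior}}_{\Lambda}$; that is, for every $\epsilon>0$ there exists $\delta>0$ such that for every perturbation $\widehat{P}^{\mathrm{prior}}_{\Lambda}$ of $P^{\mathrm{prior}}_{\Lambda}$ (as defined in the context), with conditional probabilities $\widehat{P}^{\mathrm{prior}}_q$ and associated consistent solution $\widehat{P}^{\mathrm{post}}_{\Lambda}$: if $$d_{TV}\big(P^{\mathrm{prior}}_q,\widehat{P}^{\mathrm{prior}}_q\big)<\delta\quad\text{for }\mu_{\mathcal{D}}\text{-almost every }q\in\operatorname{supp}\pi^{\mathrm{obs}}_{\mathcal{D}},$$ then $$d_{TV}\big(P^{\mathrm{post}}_{\Lambda},\widehat{P}^{\mathrm{post}}_{\Lambda}\big)<\epsilon.$$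
   Context: Setting. $\Lambda\subset\mathbb{R}^n$ and $\mathcal{D}\subset\mathbb{R}^m$ are finite-dimensional metric spaces with Borel $\sigma$-algebras $\mathcal{B}_{\Lambda}$, $\mathcal{B}_{\mathcal{D}}$ and (volume) measures $\mu_{\Lambda}$, $\mu_{\mathcal{D}}$. $Q:\Lambda\to\mathcal{D}$ is a measurable map and $\mathcal{D}=Q(\Lambda)$. Assumption 1: either $\mu_{\mathcal{D}}$ is the push-forward volume measure $A\mapsto\mu_{\Lambda}(Q^{-1}(A))$, or the push-forward volume measure is absolutely continuous with respect to $\mu_{\mathcal{D}}$. The family $\{\mu_{\Lambda,q}\}_{q\in\mathcal{D}}$ is the disintegration of $\mu_{\Lambda}$ along $Q$ with respect to $\mu_{\mathcal{D}}$: each $\mu_{\Lambda,q}$ is a measure on $(\Lambda,\mathcal{B}_{\Lambda})$ with $\mu_{\Lambda,q}(\Lambda\setminus Q^{-1}(q))=0$, for each $A\in\mathcal{B}_{\Lambda}$ the map $q\mapsto\mu_{\Lambda,q}(A)$ is measurable, and $\mu_{\Lambda}(A)=\int_{\mathcal{D}}\mu_{\Lambda,q}(A\cap Q^{-1}(q))\,d\mu_{\mathcal{D}}(q)$. The prior $P^{\mathrm{prior}}_{\Lambda}$ is a probability measure on $(\Lambda,\mathcal{B}_{\Lambda})$ with density $\pi^{\mathrm{prior}}_{\Lambda}$ with respect to $\mu_{\Lambda}$. Its push-forward $P^{Q(\mathrm{prior})}_{\mathcal{D}}(A)=P^{\mathrm{prior}}_{\Lambda}(Q^{-1}(A))$ has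 density $\pi^{Q(\mathrm{prior})}_{\mathcal{D}}$ with respect to $\mu_{\mathcal{D}}$, given by $\pi^{Q(\mathrm{prior})}_{\mathcal{D}}(q)=\int_{Q^{-1}(q)}\pi^{\mathrm{prior}}_{\Lambda}(\lambda)\,d\mu_{\Lambda,q}(\lambda)$. The observed measure $P^{\mathrm{obs}}_{\mathcal{D}}$ is a probability measure on $(\mathcal{D},\mathcal{B}_{\mathcal{D}})$ with density $\pi^{\mathrm{obs}}_{\mathcal{D}}$ with respect to $\mu_{\mathcal{D}}$; $\operatorname{supp}\pi^{\mathrm{obs}}_{\mathcal{D}}$ denotes $\{q\in\mathcal{D}:\pi^{\mathrm{obs}}_{\mathcal{D}}(q)>0\}$. Assumption 2: there is a constant $C>0$ such that $\pi^{\mathrm{obs}}_{\mathcal{D}}(q)\le C\,\pi^{Q(\mathrm{prior})}_{\mathcal{D}}(q)$ for $\mu_{\mathcal{D}}$-a.e. $q\in\mathcal{D}$. Convention: a quotient is read as $0$ at points where its denominator vanishes. The consistent solution associated with $P^{\mathrm{prior}}_{\Lambda}$ and $P^{\mathrm{obs}}_{\mathcal{D}}$ is $$P^{\mathrm{post}}_{\Lambda}(A)=\int_{\mathcal{D}}\left(\int_{A\cap Q^{-1}(q)}\pi^{\mathrm{prior}}_{\Lambda}(\lambda)\,\frac{\pi^{\mathrm{obs}}_{\mathcal{D}}(Q(\lambda))}{\pi^{Q(\mathrm{prior})}_{\mathcal{D}}(Q(\lambda))}\,d\mu_{\Lambda,q}(\lambda)\right)d\mu_{\mathcal{D}}(q),\quad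 A\in\mathcal{B}_{\Lambda},$$ whose density with respect to $\mu_{\Lambda}$ is $\pi^{\mathrm{post}}_{\Lambda}(\lambda)=\pi^{\mathrm{prior}}_{\Lambda}(\lambda)\,\pi^{\mathrm{obs}}_{\mathcal{D}}(Q(\lambda))/\pi^{Q(\mathrm{prior})}_{\mathcal{D}}(Q(\lambda))$. The conditional probabilities $P^{\mathrm{prior}}_q$ from the disintegration of $P^{\mathrm{prior}}_{\Lambda}$ along $Q$ are concentrated on $Q^{-1}(q)$ and have density $\pi^{\mathrm{prior}}_q(\lambda)=\pi^{\mathrm{prior}}_{\Lambda}(\lambda)/\pi^{Q(\mathrm{prior})}_{\mathcal{D}}(Q(\lambda))$ with respect to $\mu_{\Lambda,q}$. A perturbation of $P^{\mathrm{prior}}_{\Lambda}$ is any probability measure $\widehat{P}^{\mathrm{prior}}_{\Lambda}$ on $(\Lambda,\mathcal{B}_{\Lambda})$ with a density $\widehat{\pi}^{\mathrm{prior}}_{\Lambda}$ with respect to $\mu_{\Lambda}$ such that Assumption 2 is still valid with $\widehat{P}^{\mathrm{prior}}_{\Lambda}$ as prior and the same $P^{\mathrm{obs}}_{\mathcal{D}}$ (for some constant $C'>0$). Its push-forward density, conditional probabilities $\widehat{P}^{\mathrm{prior}}_q$ and associated consistent solution $\widehat{P}^{\mathrm{post}}_{\Lambda}$ are defined by the same formulas with $\widehat{P}^{\mathrm{prior}}_{\Lambda}$ in place of $P^{\mathrm{prior}}_{\Lambda}$. Total variation distance (without factor $1/2$): for measures on $\Lambda$ with densities $\pi_1,\pi_2$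 with respect to $\mu_{\Lambda}$, $d_{TV}=\int_{\Lambda}|\pi_1-\pi_2|\,d\mu_{\Lambda}$; for the conditional probabilities, $d_{TV}(P^{\mathrm{prior}}_q,\widehat{P}^{\mathrm{prior}}_q)=\int_{Q^{-1}(q)}|\pi^{\mathrm{prior}}_q-\widehat{\pi}^{\mathrm{prior}}_q|\,d\mu_{\Lambda,q}$. *)

theory Defs
  imports "HOL-Probability.Probability"
begin

text \<open>Throughout, \<open>M\<close> is the measure on the parameter space, \<open>N\<close> the measure on the data
  space, \<open>Q\<close> the map between them and \<open>\<kappa>\<close> the family of measures on the fibres of \<open>Q\<close>.\<close>

definition fibre :: "'a measure \<Rightarrow> ('a \<Rightarrow> 'b) \<Rightarrow> 'b \<Rightarrow> 'a set" where
  "fibre M Q q = Q -` {q} \<inter> space M"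

definition disintegration ::
    "'a measure \<Rightarrow> 'b measure \<Rightarrow> ('a \<Rightarrow> 'b) \<Rightarrow> ('b \<Rightarrow> 'a measure) \<Rightarrow> bool" where
  "disintegration M N Q \<kappa> \<longleftrightarrow>
     (\<forall>q\<in>space N. sets (\<kappa> q) = sets M \<and> emeasure (\<kappa> q) (space M - fibre M Q q) = 0) \<and>
     (\<forall>A\<in>sets M. (\<lambda>q. emeasure (\<kappa> q) A) \<in> borel_measurable N) \<and>
     (\<forall>A\<in>sets M. emeasure M A = (\<integral>\<^sup>+q. emeasure (\<kappa> q) (A \<inter> fibre M Q q) \<partial>N))"

definition has_density :: "'a measure \<Rightarrow> 'a measure \<Rightarrow> ('a \<Rightarrow> real) \<Rightarrow> bool" where
  "has_density M P \<pi> \<longleftrightarrow>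
     \<pi> \<in> borel_measurable M \<and> (\<forall>x\<in>space M. 0 \<le> \<pi> x) \<and> P = density M (\<lambda>x. ennreal (\<pi> x))"

text \<open>Density of the push-forward of the prior. The fibre integral of the prior density may be
  infinite for \<open>q\<close> in an \<open>N\<close>-null set; there the Bochner integral has the value 0.\<close>

definition push_density ::
    "'a measure \<Rightarrow> ('a \<Rightarrow> 'b) \<Rightarrow> ('b \<Rightarrow> 'a measure) \<Rightarrow> ('a \<Rightarrow> real) \<Rightarrow> 'b \<Rightarrow> real" where
  "push_density M Q \<kappa> \<pi> q = (LINT x:fibre M Q q|\<kappa> q. \<pi> x)"

definition predictable ::
    "'a measure \<Rightarrow> 'b measure \<Rightarrow> ('a \<Rightarrow> 'b) \<Rightarrow> ('b \<Rightarrow> 'a measure) \<Rightarrow> ('b \<Rightarrow> real) \<Rightarrow> ('a \<Rightarrow> real) \<Rightarrow> bool"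
  where
  "predictable M N Q \<kappa> \<pi>obs \<pi> \<longleftrightarrow>
     (\<exists>C>0. AE q in N. \<pi>obs q \<le> C * push_density M Q \<kappa> \<pi> q)"

text \<open>Real division by 0 yields 0, which is the convention for quotients wanted in the next two
  definitions. In the second one, the set function is countably additive as soon as \<open>\<kappa>\<close> is a
  disintegration of \<open>M\<close> along \<open>Q\<close> and the data are measurable, so \<open>measure_of\<close> does not fall
  back to the zero measure.\<close>

definition cond_prior ::
    "'a measure \<Rightarrow> ('a \<Rightarrow> 'b) \<Rightarrow> ('b \<Rightarrow> 'a measure) \<Rightarrow> ('a \<Rightarrow> real) \<Rightarrow> 'b \<Rightarrow> 'a measure" where
  "cond_prior M Q \<kappa> \<pi> q = density (\<kappa> q) (\<lambda>x. ennreal (\<pi> x / push_density M Q \<kappa> \<pi> (Q x)))"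

definition consistent_solution ::
    "'a measure \<Rightarrow> 'b measure \<Rightarrow> ('a \<Rightarrow> 'b) \<Rightarrow> ('b \<Rightarrow> 'a measure) \<Rightarrow> ('b \<Rightarrow> real) \<Rightarrow> ('a \<Rightarrow> real) \<Rightarrow> 'a measure"
  where
  "consistent_solution M N Q \<kappa> \<pi>obs \<pi> =
     measure_of (space M) (sets M)
       (\<lambda>A. \<integral>\<^sup>+q. (\<integral>\<^sup>+x\<in>A \<inter> fibre M Q q.
              ennreal (\<pi> x * (\<pi>obs (Q x) / push_density M Q \<kappa> \<pi> (Q x))) \<partial>\<kappa> q) \<partial>N)"

text \<open>Total variation distance, without the factor 1/2, of two measures having densities with
  respect to \<open>M\<close>, the integral being taken over \<open>S\<close>. The value is an extended nonnegative real,
  so that an infinite integral does not collapse to 0. It does not depend on the densities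
  chosen by \<open>RN_deriv\<close> when the two measures are finite.\<close>

definition tv_dist :: "'a measure \<Rightarrow> 'a set \<Rightarrow> 'a measure \<Rightarrow> 'a measure \<Rightarrow> ennreal" where
  "tv_dist M S P1 P2 =
     (\<integral>\<^sup>+x\<in>S. ennreal \<bar>enn2real (RN_deriv M P1 x) - enn2real (RN_deriv M P2 x)\<bar> \<partial>M)"

definition perturbation ::
    "'a measure \<Rightarrow> 'b measure \<Rightarrow> ('a \<Rightarrow> 'b) \<Rightarrow> ('b \<Rightarrow> 'a measure) \<Rightarrow> ('b \<Rightarrow> real) \<Rightarrow>
      'a measure \<Rightarrow> ('a \<Rightarrow> real) \<Rightarrow> bool" where
  "perturbation M N Q \<kappa> \<pi>obs P \<pi> \<longleftrightarrow>
     prob_space P \<and> has_density M P \<pi> \<and> predictable M N Q \<kappa> \<pi>obs \<pi>"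

end

theory Submission
  imports Defs
begin

text \<open>The posterior and the prior have the same conditional probabilities on the fibres of
  \<open>Q\<close> over almost every point where \<open>\<pi>obs\<close> is positive: the posterior density at \<open>x\<close> is the conditional prior density
  \<open>\<pi> x / push_density M Q \<kappa> \<pi> (Q x)\<close> times the weight \<open>\<pi>obs (Q x)\<close>, which is constant on each
  fibre and does not involve the prior. Changing the prior therefore changes the posterior
  only through the conditionals. Disintegrating the \<open>L\<^sup>1\<close> distance of two posterior densities
  (\<open>tv_dist_consistent_solution\<close>) gives the integral of
  \<open>\<pi>obs q * tv_dist (\<kappa> q) (fibre M Q q) (cond_prior M Q \<kappa> \<pi> q) (cond_prior M Q \<kappa> \<pi>' q)\<close> over \<open>q\<close>,
  an average of the distances of the conditionals against a probability density. If these are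
  below \<open>\<delta>\<close> wherever \<open>\<pi>obs\<close> is positive, the average is at most \<open>\<delta>\<close>, and \<open>\<delta> = \<epsilon> / 2\<close> works.

  Two points need care. The disintegration is given for sets only and has to be extended to
  integrands (\<open>nn_integral_disintegration\<close>). And the total variation distance refers to
  Radon-Nikodym derivatives while the measures involved need not be \<open>\<sigma>\<close>-finite; but a density with
  finite integral is almost everywhere unique with respect to any measure (\<open>RN_deriv_density_finite\<close>),
  and the conditional and posterior densities have integral at most 1.\<close>

section \<open>Total variation distance of measures with integrable densities\<close>

text \<open>\<open>RN_deriv\<close> picks some density. Integrating it over the whole space gives the total mass
  of the measure, so it has the same finite integral as \<open>f\<close>, and densities with finite integral
  are unique without \<open>\<sigma>\<close>-finiteness.\<close>

lemma RN_deriv_density_finite: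
  assumes [measurable]: "f \<in> borel_measurable M" and fin: "(\<integral>\<^sup>+x. f x \<partial>M) < \<infinity>"
  shows "AE x in M. RN_deriv M (density M f) x = f x"
proof -
  have eq: "density M (RN_deriv M (density M f)) = density M f"
    by (rule density_RN_deriv_density) simp
  have "(\<integral>\<^sup>+x. RN_deriv M (density M f) x \<partial>M)
      = emeasure (density M (RN_deriv M (density M f))) (space M)"
    by (simp add: emeasure_density cong: nn_integral_cong)
  also have "\<dots> = (\<integral>\<^sup>+x. f x \<partial>M)"
    unfolding eq by (simp add: emeasure_density cong: nn_integral_cong)
  finally have "(\<integral>\<^sup>+x. RN_deriv M (density M f) x \<partial>M) \<noteq> \<infinity>"
    using fin by simp
  then have "density M (RN_deriv M (density M f)) = density M f \<longleftrightarrow>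
      (AE x in M. RN_deriv M (density M f) x = f x)"
    by (intro finite_density_unique) auto
  with eq show ?thesis
    by simp
qed

lemma tv_dist_density:
  fixes f g :: "'a \<Rightarrow> real"
  assumes [measurable]: "f \<in> borel_measurable M" "g \<in> borel_measurable M"
    and nonneg: "\<And>x. x \<in> space M \<Longrightarrow> 0 \<le> f x" "\<And>x. x \<in> space M \<Longrightarrow> 0 \<le> g x"
    and fin: "(\<integral>\<^sup>+x. f x \<partial>M) < \<infinity>" "(\<integral>\<^sup>+x. g x \<partial>M) < \<infinity>"
    and full: "AE x in M. x \<in> S"
  shows "tv_dist M S (density M f) (density M g) = (\<integral>\<^sup>+x. \<bar>f x - g x\<bar> \<partial>M)"
  unfolding tv_dist_def
proof (rule nn_integral_cong_AE)
  have f: "AE x in M. RN_deriv M (density M f) x = f x"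
    by (rule RN_deriv_density_finite) (use fin in auto)
  have g: "AE x in M. RN_deriv M (density M g) x = g x"
    by (rule RN_deriv_density_finite) (use fin in auto)
  show "AE x in M. ennreal \<bar>enn2real (RN_deriv M (density M f) x)
      - enn2real (RN_deriv M (density M g) x)\<bar> * indicator S x = ennreal \<bar>f x - g x\<bar>"
    using f g full AE_space by eventually_elim (simp add: nonneg)
qed

section \<open>Integration along a disintegration\<close>

locale disintegrated_map =
  fixes M :: "'a measure" and N :: "'b measure" and Q :: "'a \<Rightarrow> 'b" and \<kappa> :: "'b \<Rightarrow> 'a measure"
  assumes Q_measurable [measurable]: "Q \<in> measurable M N"
    and singletons: "q \<in> space N \<Longrightarrow> {q} \<in> sets N"
    and disintegration: "disintegration M N Q \<kappa>"
begin

lemma sets_fibre_measure: "q \<in> space N \<Longrightarrow> sets (\<kappa> q) = sets M"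
  using disintegration by (simp add: disintegration_def)

lemma space_fibre_measure: "q \<in> space N \<Longrightarrow> space (\<kappa> q) = space M"
  by (rule sets_eq_imp_space_eq) (rule sets_fibre_measure)

lemma measurable_fibre_measure:
  "q \<in> space N \<Longrightarrow> f \<in> borel_measurable M \<Longrightarrow> f \<in> borel_measurable (\<kappa> q)"
  using measurable_cong_sets[OF sets_fibre_measure refl] by blast

lemma fibre_measurable: "q \<in> space N \<Longrightarrow> fibre M Q q \<in> sets M"
  unfolding fibre_def by (rule measurable_sets[OF Q_measurable singletons])

lemma AE_in_fibre:
  assumes q: "q \<in> space N"
  shows "AE x in \<kappa> q. x \<in> fibre M Q q"
proof (rule AE_I')
  show "space M - fibre M Q q \<in> null_sets (\<kappa> q)"
    using disintegration q fibre_measurable[OF q] by (auto simp: disintegration_def null_sets_def)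
qed (use space_fibre_measure[OF q] in auto)

lemma nn_integral_over_fibre:
  assumes q: "q \<in> space N"
  shows "(\<integral>\<^sup>+x\<in>A \<inter> fibre M Q q. f x \<partial>\<kappa> q) = (\<integral>\<^sup>+x\<in>A. f x \<partial>\<kappa> q)"
  by (rule nn_integral_cong_AE)
    (use AE_in_fibre[OF q] in \<open>eventually_elim, auto simp: indicator_def\<close>)

text \<open>Both facts pass from indicators to all nonnegative functions along the usual
  approximation by simple functions. They are proved together because monotone convergence in the
  second one uses measurability of the inner integrals.\<close>

lemma measurable_and_nn_integral_disintegration:
  fixes f :: "'a \<Rightarrow> ennreal"
  assumes "f \<in> borel_measurable M"
  shows "(\<lambda>q. \<integral>\<^sup>+x. f x \<partial>\<kappa> q) \<in> borel_measurable N \<and>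
    (\<integral>\<^sup>+x. f x \<partial>M) = (\<integral>\<^sup>+q. (\<integral>\<^sup>+x. f x \<partial>\<kappa> q) \<partial>N)"
  using assms
proof (induction f rule: borel_measurable_induct)
  case (cong f g)
  have "(\<integral>\<^sup>+x. f x \<partial>\<kappa> q) = (\<integral>\<^sup>+x. g x \<partial>\<kappa> q)" if "q \<in> space N" for q
    using cong(3) space_fibre_measure[OF that] by (intro nn_integral_cong) auto
  moreover have "(\<integral>\<^sup>+x. f x \<partial>M) = (\<integral>\<^sup>+x. g x \<partial>M)"
    using cong(3) by (rule nn_integral_cong)
  ultimately show ?case
    using cong(4) by (simp cong: measurable_cong nn_integral_cong)
next
  case (set A)
  have ind: "(\<integral>\<^sup>+x. indicator A x \<partial>\<kappa> q) = emeasure (\<kappa> q) A" if "q \<in> space N" for q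
    using set sets_fibre_measure[OF that] by simp
  have fib: "emeasure (\<kappa> q) (A \<inter> fibre M Q q) = emeasure (\<kappa> q) A" if q: "q \<in> space N" for q
  proof (rule emeasure_eq_AE)
    show "A \<inter> fibre M Q q \<in> sets (\<kappa> q)"
      using set fibre_measurable[OF q] sets_fibre_measure[OF q] by auto
  qed (use AE_in_fibre[OF q] set sets_fibre_measure[OF q] in auto)
  have "(\<lambda>q. emeasure (\<kappa> q) A) \<in> borel_measurable N"
    using disintegration set by (simp add: disintegration_def)
  moreover have "emeasure M A = (\<integral>\<^sup>+q. emeasure (\<kappa> q) A \<partial>N)"
    using disintegration set by (simp add: disintegration_def fib cong: nn_integral_cong)
  ultimately show ?case
    using set by (simp add: ind cong: measurable_cong nn_integral_cong)
next
  case (mult u c)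
  have "(\<integral>\<^sup>+x. c * u x \<partial>\<kappa> q) = c * (\<integral>\<^sup>+x. u x \<partial>\<kappa> q)" if "q \<in> space N" for q
    using mult by (intro nn_integral_cmult measurable_fibre_measure[OF that])
  moreover have "(\<lambda>q. c * (\<integral>\<^sup>+x. u x \<partial>\<kappa> q)) \<in> borel_measurable N"
    using mult by (intro borel_measurable_times_ennreal) auto
  ultimately show ?case
    using mult by (simp add: nn_integral_cmult cong: measurable_cong nn_integral_cong)
next
  case (add u v)
  have "(\<integral>\<^sup>+x. v x + u x \<partial>\<kappa> q) = (\<integral>\<^sup>+x. v x \<partial>\<kappa> q) + (\<integral>\<^sup>+x. u x \<partial>\<kappa> q)"
    if "q \<in> space N" for q
    using add by (intro nn_integral_add measurable_fibre_measure[OF that])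
  moreover have "(\<lambda>q. (\<integral>\<^sup>+x. v x \<partial>\<kappa> q) + (\<integral>\<^sup>+x. u x \<partial>\<kappa> q)) \<in> borel_measurable N"
    using add by (intro borel_measurable_add) auto
  ultimately show ?case
    using add by (simp add: nn_integral_add cong: measurable_cong nn_integral_cong)
next
  case (seq U)
  have "(\<integral>\<^sup>+x. (\<Squnion>i. U i x) \<partial>\<kappa> q) = (\<Squnion>i. \<integral>\<^sup>+x. U i x \<partial>\<kappa> q)" if "q \<in> space N" for q
    using measurable_fibre_measure[OF that] seq by (intro nn_integral_monotone_convergence_SUP) auto
  note inner = this
  have "incseq (\<lambda>i q. \<integral>\<^sup>+x. U i x \<partial>\<kappa> q)"
    using seq(3) by (auto simp: incseq_def le_fun_def intro!: nn_integral_mono)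
  then have "(\<integral>\<^sup>+q. (\<Squnion>i. \<integral>\<^sup>+x. U i x \<partial>\<kappa> q) \<partial>N) = (\<Squnion>i. \<integral>\<^sup>+q. (\<integral>\<^sup>+x. U i x \<partial>\<kappa> q) \<partial>N)"
    using seq by (intro nn_integral_monotone_convergence_SUP) auto
  moreover have "(\<integral>\<^sup>+x. (\<Squnion>i. U i x) \<partial>M) = (\<Squnion>i. \<integral>\<^sup>+x. U i x \<partial>M)"
    using seq by (intro nn_integral_monotone_convergence_SUP) auto
  moreover have "(\<lambda>q. \<Squnion>i. \<integral>\<^sup>+x. U i x \<partial>\<kappa> q) \<in> borel_measurable N"
    using seq by (intro borel_measurable_SUP) auto
  ultimately show ?case
    using seq inner by (simp add: image_comp cong: measurable_cong nn_integral_cong)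
qed

lemmas measurable_nn_integral_fibre [measurable] =
  measurable_and_nn_integral_disintegration[THEN conjunct1]

lemmas nn_integral_disintegration =
  measurable_and_nn_integral_disintegration[THEN conjunct2]

section \<open>Conditional densities and the posterior density\<close>

text \<open>This form exhibits measurability in \<open>q\<close>; it also covers the fibres with infinite prior
  mass, where \<open>enn2real\<close> and the Bochner integral both take the value 0.\<close>

lemma push_density_eq:
  assumes q: "q \<in> space N" and "\<pi> \<in> borel_measurable M" and "\<And>x. x \<in> space M \<Longrightarrow> 0 \<le> \<pi> x"
  shows "push_density M Q \<kappa> \<pi> q = enn2real (\<integral>\<^sup>+x. \<pi> x \<partial>\<kappa> q)"
proof -
  have "push_density M Q \<kappa> \<pi> q = (\<integral>x. \<pi> x \<partial>\<kappa> q)"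
    unfolding push_density_def set_lebesgue_integral_def
  proof (rule integral_cong_AE)
    show "(\<lambda>x. indicator (fibre M Q q) x *\<^sub>R \<pi> x) \<in> borel_measurable (\<kappa> q)"
      using assms(2) fibre_measurable[OF q]
      by (intro measurable_fibre_measure[OF q] borel_measurable_scaleR borel_measurable_indicator)
    show "\<pi> \<in> borel_measurable (\<kappa> q)"
      using assms by (intro measurable_fibre_measure)
    show "AE x in \<kappa> q. indicator (fibre M Q q) x *\<^sub>R \<pi> x = \<pi> x"
      using AE_in_fibre[OF q] by eventually_elim simp
  qed
  also have "\<dots> = enn2real (\<integral>\<^sup>+x. \<pi> x \<partial>\<kappa> q)"
    using assms space_fibre_measure[OF q] by (intro integral_eq_nn_integral measurable_fibre_measure) auto
  finally show ?thesis .
qed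

lemma measurable_push_density:
  assumes [measurable]: "\<pi> \<in> borel_measurable M" and "\<And>x. x \<in> space M \<Longrightarrow> 0 \<le> \<pi> x"
  shows "push_density M Q \<kappa> \<pi> \<in> borel_measurable N"
proof -
  have "(\<lambda>q. enn2real (\<integral>\<^sup>+x. \<pi> x \<partial>\<kappa> q)) \<in> borel_measurable N"
    by measurable
  then show ?thesis
    using assms by (simp add: push_density_eq cong: measurable_cong)
qed

lemma push_density_nonneg:
  assumes "q \<in> space N" "\<pi> \<in> borel_measurable M" "\<And>x. x \<in> space M \<Longrightarrow> 0 \<le> \<pi> x"
  shows "0 \<le> push_density M Q \<kappa> \<pi> q"
  using assms by (simp add: push_density_eq)

definition cond_density :: "('a \<Rightarrow> real) \<Rightarrow> 'a \<Rightarrow> real" where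
  "cond_density \<pi> x = \<pi> x / push_density M Q \<kappa> \<pi> (Q x)"

lemma measurable_cond_density:
  assumes [measurable]: "\<pi> \<in> borel_measurable M" and "\<And>x. x \<in> space M \<Longrightarrow> 0 \<le> \<pi> x"
  shows "cond_density \<pi> \<in> borel_measurable M"
proof -
  note measurable_push_density[OF assms, measurable]
  show ?thesis unfolding cond_density_def[abs_def] by measurable
qed

lemma cond_density_nonneg:
  assumes "\<pi> \<in> borel_measurable M" "\<And>x. x \<in> space M \<Longrightarrow> 0 \<le> \<pi> x" "x \<in> space M"
  shows "0 \<le> cond_density \<pi> x"
  using assms push_density_nonneg[of "Q x" \<pi>] measurable_space[OF Q_measurable]
  by (simp add: cond_density_def)

text \<open>On the fibre over \<open>q\<close> the conditional density is \<open>\<pi>\<close> divided by its own fibre integral, so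
  it integrates to 1, unless that fibre integral is 0 or infinite and the quotient is 0.\<close>

lemma nn_integral_cond_density_le_1:
  assumes q: "q \<in> space N" and [measurable]: "\<pi> \<in> borel_measurable M"
    and nonneg: "\<And>x. x \<in> space M \<Longrightarrow> 0 \<le> \<pi> x"
  shows "(\<integral>\<^sup>+x. cond_density \<pi> x \<partial>\<kappa> q) \<le> 1"
proof -
  let ?p = "push_density M Q \<kappa> \<pi> q"
  have p: "?p = enn2real (\<integral>\<^sup>+x. \<pi> x \<partial>\<kappa> q)"
    by (rule push_density_eq) (use assms in auto)
  have "(\<integral>\<^sup>+x. cond_density \<pi> x \<partial>\<kappa> q) = (\<integral>\<^sup>+x. ennreal (1 / ?p) * ennreal (\<pi> x) \<partial>\<kappa> q)"
  proof (rule nn_integral_cong_AE)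
    show "AE x in \<kappa> q. ennreal (cond_density \<pi> x) = ennreal (1 / ?p) * ennreal (\<pi> x)"
      using AE_in_fibre[OF q]
    proof eventually_elim
      case (elim x)
      then have "x \<in> space M" "Q x = q"
        by (auto simp: fibre_def)
      then show ?case
        using nonneg p by (simp add: cond_density_def ennreal_mult[symmetric])
    qed
  qed
  also have "\<dots> = ennreal (1 / ?p) * (\<integral>\<^sup>+x. \<pi> x \<partial>\<kappa> q)"
    by (rule nn_integral_cmult) (auto intro: measurable_fibre_measure[OF q])
  also have "\<dots> \<le> 1"
  proof (cases "?p = 0")
    case False
    then have "(\<integral>\<^sup>+x. \<pi> x \<partial>\<kappa> q) = ennreal ?p"
      using p by (cases "\<integral>\<^sup>+x. \<pi> x \<partial>\<kappa> q") auto
    then have "ennreal (1 / ?p) * (\<integral>\<^sup>+x. \<pi> x \<partial>\<kappa> q) = ennreal (1 / ?p) * ennreal ?p"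
      by (rule arg_cong)
    also have "\<dots> = ennreal (1 / ?p * ?p)"
      using p by (intro ennreal_mult[symmetric]) auto
    finally show ?thesis
      using False by simp
  qed simp
  finally show ?thesis .
qed

text \<open>Disintegration of an integral whose integrand is weighted by a function of \<open>Q x\<close>: on a
  fibre the weight is a constant and leaves the inner integral.\<close>

lemma nn_integral_weighted_disintegration:
  fixes w :: "'b \<Rightarrow> ennreal" and f :: "'a \<Rightarrow> ennreal"
  assumes [measurable]: "w \<in> borel_measurable N" "f \<in> borel_measurable M"
  shows "(\<integral>\<^sup>+x. w (Q x) * f x \<partial>M) = (\<integral>\<^sup>+q. w q * (\<integral>\<^sup>+x. f x \<partial>\<kappa> q) \<partial>N)"
proof -
  have "(\<integral>\<^sup>+x. w (Q x) * f x \<partial>\<kappa> q) = w q * (\<integral>\<^sup>+x. f x \<partial>\<kappa> q)" if q: "q \<in> space N" for q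
  proof -
    have "(\<integral>\<^sup>+x. w (Q x) * f x \<partial>\<kappa> q) = (\<integral>\<^sup>+x. w q * f x \<partial>\<kappa> q)"
      by (rule nn_integral_cong_AE)
        (use AE_in_fibre[OF q] in \<open>eventually_elim, auto simp: fibre_def\<close>)
    also have "\<dots> = w q * (\<integral>\<^sup>+x. f x \<partial>\<kappa> q)"
      by (rule nn_integral_cmult) (auto intro: measurable_fibre_measure[OF q])
    finally show ?thesis .
  qed
  moreover have "(\<integral>\<^sup>+x. w (Q x) * f x \<partial>M) = (\<integral>\<^sup>+q. (\<integral>\<^sup>+x. w (Q x) * f x \<partial>\<kappa> q) \<partial>N)"
    by (rule nn_integral_disintegration) measurable
  ultimately show ?thesis
    by (simp cong: nn_integral_cong)
qed

lemma consistent_solution_eq_density: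
  assumes [measurable]: "\<pi> \<in> borel_measurable M" "\<pi>obs \<in> borel_measurable N"
    and nonneg: "\<And>x. x \<in> space M \<Longrightarrow> 0 \<le> \<pi> x"
  shows "consistent_solution M N Q \<kappa> \<pi>obs \<pi> = density M (\<lambda>x. \<pi>obs (Q x) * cond_density \<pi> x)"
proof -
  note measurable_cond_density[OF assms(1) nonneg, measurable]
  let ?h = "\<lambda>x. ennreal (\<pi>obs (Q x) * cond_density \<pi> x)"
  have "emeasure (density M ?h) A = (\<integral>\<^sup>+q. (\<integral>\<^sup>+x\<in>A \<inter> fibre M Q q.
              ennreal (\<pi> x * (\<pi>obs (Q x) / push_density M Q \<kappa> \<pi> (Q x))) \<partial>\<kappa> q) \<partial>N)"
    if [measurable]: "A \<in> sets M" for A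
  proof -
    have "emeasure (density M ?h) A = (\<integral>\<^sup>+x\<in>A. ?h x \<partial>M)"
      by (rule emeasure_density) measurable
    also have "\<dots> = (\<integral>\<^sup>+q. (\<integral>\<^sup>+x\<in>A. ?h x \<partial>\<kappa> q) \<partial>N)"
      by (rule nn_integral_disintegration) measurable
    also have "\<dots> = (\<integral>\<^sup>+q. (\<integral>\<^sup>+x\<in>A \<inter> fibre M Q q. ?h x \<partial>\<kappa> q) \<partial>N)"
      by (simp add: nn_integral_over_fibre cong: nn_integral_cong)
    finally show ?thesis
      by (simp add: cond_density_def mult.commute)
  qed
  then have "consistent_solution M N Q \<kappa> \<pi>obs \<pi>
      = measure_of (space M) (sets M) (emeasure (density M ?h))"
    unfolding consistent_solution_def
    by (intro measure_of_eq) (auto simp: sets.space_closed sets.sigma_sets_eq)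
  also have "\<dots> = density M ?h"
    using measure_of_of_measure[of "density M ?h"] by simp
  finally show ?thesis .
qed

section \<open>Comparison of posteriors through their conditionals\<close>

lemma tv_dist_cond_prior:
  assumes q: "q \<in> space N"
    and "\<pi> \<in> borel_measurable M" "\<And>x. x \<in> space M \<Longrightarrow> 0 \<le> \<pi> x"
    and "\<pi>' \<in> borel_measurable M" "\<And>x. x \<in> space M \<Longrightarrow> 0 \<le> \<pi>' x"
  shows "tv_dist (\<kappa> q) (fibre M Q q) (cond_prior M Q \<kappa> \<pi> q) (cond_prior M Q \<kappa> \<pi>' q)
    = (\<integral>\<^sup>+x. \<bar>cond_density \<pi> x - cond_density \<pi>' x\<bar> \<partial>\<kappa> q)"
  unfolding cond_prior_def cond_density_def[symmetric]
proof (rule tv_dist_density)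
  show "cond_density \<pi> \<in> borel_measurable (\<kappa> q)" "cond_density \<pi>' \<in> borel_measurable (\<kappa> q)"
    using assms by (auto intro!: measurable_fibre_measure measurable_cond_density)
  show "(\<integral>\<^sup>+x. cond_density \<pi> x \<partial>\<kappa> q) < \<infinity>" "(\<integral>\<^sup>+x. cond_density \<pi>' x \<partial>\<kappa> q) < \<infinity>"
    using nn_integral_cond_density_le_1[OF q assms(2,3)] nn_integral_cond_density_le_1[OF q assms(4,5)]
    by (auto intro: le_less_trans[where y = 1])
  show "AE x in \<kappa> q. x \<in> fibre M Q q"
    by (rule AE_in_fibre[OF q])
qed (use assms space_fibre_measure[OF q] cond_density_nonneg in auto)

text \<open>The two posterior densities carry the same weight \<open>\<pi>obs (Q x)\<close>, which factors out of their
  difference and then out of the integral over each fibre; what remains there is the distance of the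
  conditionals.\<close>

theorem tv_dist_consistent_solution:
  assumes [measurable]: "\<pi>obs \<in> borel_measurable N"
    and obs_nonneg: "\<And>q. q \<in> space N \<Longrightarrow> 0 \<le> \<pi>obs q"
    and obs_fin: "(\<integral>\<^sup>+q. \<pi>obs q \<partial>N) < \<infinity>"
    and meas [measurable]: "\<pi> \<in> borel_measurable M" "\<pi>' \<in> borel_measurable M"
    and nonneg: "\<And>x. x \<in> space M \<Longrightarrow> 0 \<le> \<pi> x" "\<And>x. x \<in> space M \<Longrightarrow> 0 \<le> \<pi>' x"
  shows "tv_dist M (space M)
      (consistent_solution M N Q \<kappa> \<pi>obs \<pi>) (consistent_solution M N Q \<kappa> \<pi>obs \<pi>')
    = (\<integral>\<^sup>+q. \<pi>obs q * tv_dist (\<kappa> q) (fibre M Q q)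
        (cond_prior M Q \<kappa> \<pi> q) (cond_prior M Q \<kappa> \<pi>' q) \<partial>N)"
proof -
  have Qx: "Q x \<in> space N" if "x \<in> space M" for x
    using measurable_space[OF Q_measurable that] .
  note c [measurable] = measurable_cond_density[OF meas(1) nonneg(1)]
    measurable_cond_density[OF meas(2) nonneg(2)]
  \<comment> \<open>The conditionals have mass at most 1, so the mass of a posterior is at most that of \<open>\<pi>obs\<close>.\<close>
  have fin: "(\<integral>\<^sup>+x. \<pi>obs (Q x) * cond_density p x \<partial>M) < \<infinity>"
    if [measurable]: "p \<in> borel_measurable M" and p: "\<And>x. x \<in> space M \<Longrightarrow> 0 \<le> p x" for p
  proof -
    note measurable_cond_density[OF that, measurable]
    have "(\<integral>\<^sup>+x. \<pi>obs (Q x) * cond_density p x \<partial>M)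
        = (\<integral>\<^sup>+x. ennreal (\<pi>obs (Q x)) * ennreal (cond_density p x) \<partial>M)"
      using obs_nonneg Qx cond_density_nonneg[OF that] by (intro nn_integral_cong ennreal_mult) auto
    also have "\<dots> = (\<integral>\<^sup>+q. ennreal (\<pi>obs q) * (\<integral>\<^sup>+x. cond_density p x \<partial>\<kappa> q) \<partial>N)"
      by (rule nn_integral_weighted_disintegration[of "\<lambda>q. ennreal (\<pi>obs q)"]) measurable
    also have "\<dots> \<le> (\<integral>\<^sup>+q. ennreal (\<pi>obs q) * 1 \<partial>N)"
      using nn_integral_cond_density_le_1[OF _ that] by (intro nn_integral_mono mult_left_mono) auto
    finally show ?thesis
      using obs_fin by (simp add: order.strict_trans1)
  qed
  have "tv_dist M (space M)
      (consistent_solution M N Q \<kappa> \<pi>obs \<pi>) (consistent_solution M N Q \<kappa> \<pi>obs \<pi>')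
    = (\<integral>\<^sup>+x. \<bar>\<pi>obs (Q x) * cond_density \<pi> x - \<pi>obs (Q x) * cond_density \<pi>' x\<bar> \<partial>M)"
    by (simp only: consistent_solution_eq_density meas assms(1) nonneg, rule tv_dist_density)
      (use fin meas nonneg obs_nonneg Qx cond_density_nonneg in auto)
  also have "\<dots> = (\<integral>\<^sup>+x. ennreal (\<pi>obs (Q x))
      * ennreal \<bar>cond_density \<pi> x - cond_density \<pi>' x\<bar> \<partial>M)"
    using obs_nonneg Qx
    by (intro nn_integral_cong)
      (simp add: ennreal_mult[symmetric] right_diff_distrib[symmetric] abs_mult)
  also have "\<dots> = (\<integral>\<^sup>+q. ennreal (\<pi>obs q)
      * (\<integral>\<^sup>+x. \<bar>cond_density \<pi> x - cond_density \<pi>' x\<bar> \<partial>\<kappa> q) \<partial>N)"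
    by (rule nn_integral_weighted_disintegration[of "\<lambda>q. ennreal (\<pi>obs q)"]) measurable
  also have "\<dots> = (\<integral>\<^sup>+q. \<pi>obs q * tv_dist (\<kappa> q) (fibre M Q q)
        (cond_prior M Q \<kappa> \<pi> q) (cond_prior M Q \<kappa> \<pi>' q) \<partial>N)"
    by (intro nn_integral_cong) (simp add: tv_dist_cond_prior meas nonneg)
  finally show ?thesis .
qed

end

section \<open>Stability of the consistent solution\<close>

theorem theorem4p2:
  fixes \<Lambda> :: "(real ^ 'n) set" and D :: "(real ^ 'm) set"
    and \<mu>\<Lambda> :: "(real ^ 'n) measure" and \<mu>D :: "(real ^ 'm) measure"
    and Q :: "real ^ 'n \<Rightarrow> real ^ 'm"
    and \<mu>fib :: "real ^ 'm \<Rightarrow> (real ^ 'n) measure"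
    and Pprior :: "(real ^ 'n) measure" and \<pi>prior :: "real ^ 'n \<Rightarrow> real"
    and Pobs :: "(real ^ 'm) measure" and \<pi>obs :: "real ^ 'm \<Rightarrow> real"
  assumes sets_\<Lambda>: "sets \<mu>\<Lambda> = sets (restrict_space borel \<Lambda>)"
    and sets_D: "sets \<mu>D = sets (restrict_space borel D)"
    and Q: "Q \<in> measurable \<mu>\<Lambda> \<mu>D"
    and D: "D = Q ` \<Lambda>"
    and assumption1: "\<mu>D = distr \<mu>\<Lambda> (restrict_space borel D) Q
                    \<or> absolutely_continuous \<mu>D (distr \<mu>\<Lambda> (restrict_space borel D) Q)"
    and disint: "disintegration \<mu>\<Lambda> \<mu>D Q \<mu>fib"
    and prior: "prob_space Pprior" "has_density \<mu>\<Lambda> Pprior \<pi>prior"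
    and obs: "prob_space Pobs" "has_density \<mu>D Pobs \<pi>obs"
    and assumption2: "predictable \<mu>\<Lambda> \<mu>D Q \<mu>fib \<pi>obs \<pi>prior"
  shows "\<forall>\<epsilon>::real. \<epsilon> > 0 \<longrightarrow> (\<exists>\<delta>::real. \<delta> > 0 \<and>
    (\<forall>Pprior' \<pi>prior'. perturbation \<mu>\<Lambda> \<mu>D Q \<mu>fib \<pi>obs Pprior' \<pi>prior' \<longrightarrow>
      (AE q in \<mu>D. \<pi>obs q > 0 \<longrightarrow>
         tv_dist (\<mu>fib q) (fibre \<mu>\<Lambda> Q q)
           (cond_prior \<mu>\<Lambda> Q \<mu>fib \<pi>prior q) (cond_prior \<mu>\<Lambda> Q \<mu>fib \<pi>prior' q) < ennreal \<delta>) \<longrightarrow>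
      tv_dist \<mu>\<Lambda> \<Lambda>
        (consistent_solution \<mu>\<Lambda> \<mu>D Q \<mu>fib \<pi>obs \<pi>prior)
        (consistent_solution \<mu>\<Lambda> \<mu>D Q \<mu>fib \<pi>obs \<pi>prior') < ennreal \<epsilon>))"
proof -
  have space_M: "space \<mu>\<Lambda> = \<Lambda>" and space_N: "space \<mu>D = D"
    using sets_eq_imp_space_eq[OF sets_\<Lambda>] sets_eq_imp_space_eq[OF sets_D]
    by (auto simp: space_restrict_space)
  interpret disintegrated_map \<mu>\<Lambda> \<mu>D Q \<mu>fib
  proof
    show "{q} \<in> sets \<mu>D" if "q \<in> space \<mu>D" for q
      using that unfolding sets_D space_N by (auto simp: sets_restrict_space image_iff intro!: bexI[of _ "{q}"])
  qed (use Q disint in auto)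
  have obs_meas [measurable]: "\<pi>obs \<in> borel_measurable \<mu>D"
    and obs_nonneg: "\<And>q. q \<in> space \<mu>D \<Longrightarrow> 0 \<le> \<pi>obs q"
    and Pobs: "Pobs = density \<mu>D \<pi>obs"
    using obs(2) by (auto simp: has_density_def)
  have obs_mass: "(\<integral>\<^sup>+q. \<pi>obs q \<partial>\<mu>D) = 1"
    using prob_space.emeasure_space_1[OF obs(1)] unfolding Pobs
    by (simp add: emeasure_density cong: nn_integral_cong)
  have meas: "\<pi>prior \<in> borel_measurable \<mu>\<Lambda>" and nonneg: "\<And>x. x \<in> space \<mu>\<Lambda> \<Longrightarrow> 0 \<le> \<pi>prior x"
    using prior(2) by (auto simp: has_density_def)
  show ?thesis
  proof (intro allI impI)
    fix \<epsilon> :: real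
    assume "\<epsilon> > 0"
    show "\<exists>\<delta>::real. \<delta> > 0 \<and>
      (\<forall>Pprior' \<pi>prior'. perturbation \<mu>\<Lambda> \<mu>D Q \<mu>fib \<pi>obs Pprior' \<pi>prior' \<longrightarrow>
        (AE q in \<mu>D. \<pi>obs q > 0 \<longrightarrow>
           tv_dist (\<mu>fib q) (fibre \<mu>\<Lambda> Q q)
             (cond_prior \<mu>\<Lambda> Q \<mu>fib \<pi>prior q) (cond_prior \<mu>\<Lambda> Q \<mu>fib \<pi>prior' q) < ennreal \<delta>) \<longrightarrow>
        tv_dist \<mu>\<Lambda> \<Lambda>
          (consistent_solution \<mu>\<Lambda> \<mu>D Q \<mu>fib \<pi>obs \<pi>prior)
          (consistent_solution \<mu>\<Lambda> \<mu>D Q \<mu>fib \<pi>obs \<pi>prior') < ennreal \<epsilon>)"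
      \<comment> \<open>The comparison of integrals below gives only a weak inequality, hence half of \<open>\<epsilon>\<close>.\<close>
    proof (intro exI[of _ "\<epsilon> / 2"] conjI allI impI)
      fix Pprior' \<pi>prior'
      let ?tv = "\<lambda>q. tv_dist (\<mu>fib q) (fibre \<mu>\<Lambda> Q q)
        (cond_prior \<mu>\<Lambda> Q \<mu>fib \<pi>prior q) (cond_prior \<mu>\<Lambda> Q \<mu>fib \<pi>prior' q)"
      assume "perturbation \<mu>\<Lambda> \<mu>D Q \<mu>fib \<pi>obs Pprior' \<pi>prior'"
      then have meas': "\<pi>prior' \<in> borel_measurable \<mu>\<Lambda>"
        and nonneg': "\<And>x. x \<in> space \<mu>\<Lambda> \<Longrightarrow> 0 \<le> \<pi>prior' x"
        by (auto simp: perturbation_def has_density_def)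
      assume close: "AE q in \<mu>D. \<pi>obs q > 0 \<longrightarrow> ?tv q < ennreal (\<epsilon> / 2)"
      have "tv_dist \<mu>\<Lambda> \<Lambda>
          (consistent_solution \<mu>\<Lambda> \<mu>D Q \<mu>fib \<pi>obs \<pi>prior)
          (consistent_solution \<mu>\<Lambda> \<mu>D Q \<mu>fib \<pi>obs \<pi>prior') = (\<integral>\<^sup>+q. \<pi>obs q * ?tv q \<partial>\<mu>D)"
        using tv_dist_consistent_solution[OF obs_meas obs_nonneg _ meas meas' nonneg nonneg']
        by (simp add: obs_mass space_M)
      also have "\<dots> \<le> (\<integral>\<^sup>+q. \<pi>obs q * ennreal (\<epsilon> / 2) \<partial>\<mu>D)"
      proof (rule nn_integral_mono_AE)
        show "AE q in \<mu>D. \<pi>obs q * ?tv q \<le> \<pi>obs q * ennreal (\<epsilon> / 2)"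
          using close
        proof eventually_elim
          case (elim q)
          show ?case
          proof (cases "\<pi>obs q > 0")
            case True
            then show ?thesis
              using elim by (intro mult_left_mono) auto
          qed (simp add: ennreal_neg)
        qed
      qed
      also have "\<dots> = ennreal (\<epsilon> / 2)"
        by (simp add: nn_integral_multc obs_mass)
      also have "\<dots> < ennreal \<epsilon>"
        using \<open>\<epsilon> > 0\<close> by (simp add: ennreal_lessI)
      finally show "tv_dist \<mu>\<Lambda> \<Lambda>
          (consistent_solution \<mu>\<Lambda> \<mu>D Q \<mu>fib \<pi>obs \<pi>prior)
          (consistent_solution \<mu>\<Lambda> \<mu>D Q \<mu>fib \<pi>obs \<pi>prior') < ennreal \<epsilon>" .
    qed (use \<open>\<epsilon> > 0\<close> in simp)
  qed
qed

end
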